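(* Let $G$ be a finite connected bipartite graph in which the degree of each vertex is at least $2$. Then there exists a uniform avoidance coupling of two simple random walks on $G$.
   Context: A simple random walk on $G=(V,E)$ moves from a vertex $v$ to each of its neighbors with probability $1/d(v)$, where $d(v)$ is the degree of $v$; $x\sim y$ means adjacent. A Markovian avoidance process of two tokens $X,Y$ on $V$ is a (time-homogeneous) Markov chain on $V\times V$ with transition probabilities $T[(x,y)\rightarrow(x',y')]$ and stationary distribution $s$, such that $s(v,v)=0$ for all $v\in V$, and whenever $s(v,w)>0$ one has $T[(v,w)\rightarrow(w,u)]=0$ for all $u\in V$ (the tokens move in turn, $X$ first). A uniform avoidance coupling of two simple random walks on $G$ is a Markovian avoidance process such that for every state $(x,y)$ with $s(x,y)>0$: $\sum_{y'}T[(x,y)\rightarrow(x',y')]$ equals $1/d(x)$ if $x'\sim x$ and $0$ otherwise, and $\sum_{x'}T[(x,y)\rightarrow(x',y')]$ equals $1/d(y)$ if $y'\sim y$ and $0$ otherwise. *)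

theory Defs
  imports
    "HOL-Probability.Probability_Mass_Function"
    "Graph_Theory.Digraph_Component"
begin

text \<open>
  Finite simple graphs are modelled by the locale \<open>graph\<close>: finite, loop-free digraphs without
  parallel arcs whose adjacency relation \<open>u \<rightarrow>\<^bsub>G\<^esub> v\<close> is symmetric. Under this encoding each edge
  contributes exactly one outgoing arc at each endpoint, so \<open>out_degree\<close> is the degree.
\<close>

definition bipartite :: "('a, 'b) pre_digraph \<Rightarrow> bool" where
  "bipartite G \<longleftrightarrow> (\<exists>A B. verts G = A \<union> B \<and> A \<inter> B = {} \<and>
     (\<forall>u v. u \<rightarrow>\<^bsub>G\<^esub> v \<longrightarrow> (u \<in> A \<and> v \<in> B) \<or> (u \<in> B \<and> v \<in> A)))"

text \<open>
  \<open>pmf (T z) z'\<close> is the transition probability from \<open>z\<close> to \<open>z'\<close>. The kernel \<open>T\<close> is a total function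
  on the ambient type; its values outside the state space \<open>S\<close> are irrelevant.
\<close>

definition markov_chain_on :: "'s set \<Rightarrow> ('s \<Rightarrow> 's pmf) \<Rightarrow> bool" where
  "markov_chain_on S T \<longleftrightarrow> (\<forall>z\<in>S. set_pmf (T z) \<subseteq> S)"

definition stationary_distribution_on :: "'s set \<Rightarrow> ('s \<Rightarrow> 's pmf) \<Rightarrow> 's pmf \<Rightarrow> bool" where
  "stationary_distribution_on S T s \<longleftrightarrow> set_pmf s \<subseteq> S \<and> bind_pmf s T = s"

definition markovian_avoidance_process ::
    "'a set \<Rightarrow> ('a \<times> 'a \<Rightarrow> ('a \<times> 'a) pmf) \<Rightarrow> ('a \<times> 'a) pmf \<Rightarrow> bool" where
  "markovian_avoidance_process V T s \<longleftrightarrow>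
     markov_chain_on (V \<times> V) T \<and>
     stationary_distribution_on (V \<times> V) T s \<and>
     (\<forall>v\<in>V. pmf s (v, v) = 0) \<and>
     (\<forall>v\<in>V. \<forall>w\<in>V. pmf s (v, w) > 0 \<longrightarrow> (\<forall>u\<in>V. pmf (T (v, w)) (w, u) = 0))"

definition srw_prob :: "('a, 'b) pre_digraph \<Rightarrow> 'a \<Rightarrow> 'a \<Rightarrow> real" where
  "srw_prob G x x' = (if x \<rightarrow>\<^bsub>G\<^esub> x' then 1 / real (out_degree G x) else 0)"

definition uniform_avoidance_coupling ::
    "('a, 'b) pre_digraph \<Rightarrow> ('a \<times> 'a \<Rightarrow> ('a \<times> 'a) pmf) \<Rightarrow> ('a \<times> 'a) pmf \<Rightarrow> bool" where
  "uniform_avoidance_coupling G T s \<longleftrightarrow>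
     markovian_avoidance_process (verts G) T s \<and>
     (\<forall>x\<in>verts G. \<forall>y\<in>verts G. pmf s (x, y) > 0 \<longrightarrow>
        (\<forall>x'\<in>verts G. (\<Sum>y'\<in>verts G. pmf (T (x, y)) (x', y')) = srw_prob G x x') \<and>
        (\<forall>y'\<in>verts G. (\<Sum>x'\<in>verts G. pmf (T (x, y)) (x', y')) = srw_prob G y y'))"

end

theory Submission
  imports Defs
begin

text \<open>
  Keep both tokens on the same side of the bipartition. Then \<open>X\<close> moves to the opposite side and
  cannot hit \<open>Y\<close>, so it only remains to couple a uniform neighbour of \<open>x\<close> with a uniform neighbour
  of \<open>y\<close> such that the two are always distinct. This is possible for uniform choices from any two
  sets with at least two elements, by a cyclic shift:
  if \<open>a \<ge> b \<ge> 2\<close> are their sizes and their common elements are listed first and in the same order,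
  take \<open>k < a b\<close> uniform and pick the elements with indices \<open>(k div b + 1) mod a\<close> and \<open>k div a\<close>.
  A stationary distribution of the resulting finite chain exists because Cesaro averages are
  almost invariant and the simplex of distributions is compact.
\<close>

section \<open>Stationary distributions of finite chains\<close>

lemma pmf_bind_finite:
  assumes "finite S" "set_pmf s \<subseteq> S"
  shows "pmf (bind_pmf s T) w = (\<Sum>z\<in>S. pmf s z * pmf (T z) w)"
  unfolding pmf_bind
  by (subst integral_measure_pmf_real[OF assms(1)]) (use assms(2) in \<open>auto simp: mult.commute\<close>)

text \<open>Vectors are total functions that vanish outside \<open>S\<close>, so that the product
  topology of the function type applies and a vector can be read directly as a mass
  function.\<close>

definition prob_vectors :: "'s set \<Rightarrow> ('s \<Rightarrow> real) set" where
  "prob_vectors S = {p. (\<forall>z. 0 \<le> p z) \<and> (\<forall>z. z \<notin> S \<longrightarrow> p z = 0) \<and> sum p S = 1}"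

text \<open>By Tychonoff: every factor of the box is compact, being a singleton for coordinates
  outside \<open>S\<close>, so the ambient type may be infinite. The simplex is cut out of the box
  by a closed condition.\<close>

lemma compact_prob_vectors:
  assumes "finite S"
  shows "compact (prob_vectors S)"
proof -
  let ?B = "PiE UNIV (\<lambda>z. if z \<in> S then {0..1::real} else {0})"
  have "compactin (product_topology (\<lambda>_. euclidean) UNIV) ?B"
    by (subst compactin_PiE) auto
  then have B: "compact ?B"
    by (simp add: euclidean_product_topology)
  have C: "closed {p :: 'a \<Rightarrow> real. sum p S = 1}"
    by (intro closed_Collect_eq continuous_intros) auto
  have "p z \<le> 1" if "p \<in> prob_vectors S" "z \<in> S" for p z
    using that assms member_le_sum[of z S p] by (auto simp: prob_vectors_def)
  then have "prob_vectors S = ?B \<inter> {p. sum p S = 1}"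
    by (fastforce simp: prob_vectors_def PiE_UNIV_domain Pi_iff split: if_splits)
  then show ?thesis
    using compact_Int_closed[OF B C] by simp
qed

lemma prob_vector_is_pmf:
  assumes "finite S" "p \<in> prob_vectors S"
  obtains s where "pmf s = p" "set_pmf s \<subseteq> S"
proof
  have nonneg: "\<And>z. 0 \<le> p z" and outside: "\<And>z. z \<notin> S \<Longrightarrow> p z = 0" and total: "sum p S = 1"
    using assms(2) by (auto simp: prob_vectors_def)
  have "(\<integral>\<^sup>+z. ennreal (p z) \<partial>count_space UNIV) = (\<Sum>z\<in>S. ennreal (p z))"
    using outside by (intro nn_integral_count_space' assms(1)) auto
  also have "\<dots> = 1"
    using nonneg total by (simp add: sum_ennreal)
  finally have one: "(\<integral>\<^sup>+z. ennreal (p z) \<partial>count_space UNIV) = 1" .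
  show "pmf (embed_pmf p) = p"
    using pmf_embed_pmf[OF nonneg one] by auto
  show "set_pmf (embed_pmf p) \<subseteq> S"
    using set_embed_pmf[OF nonneg one] outside by auto
qed

text \<open>By compactness the failure of invariance attains its minimum on the simplex, and time
  averages push that minimum down to 0. Hence no convergent subsequence has to be extracted.\<close>

lemma stationary_distribution_exists:
  assumes "finite S" "S \<noteq> {}" "markov_chain_on S T"
  shows "\<exists>s. stationary_distribution_on S T s"
proof -
  \<comment> \<open>The L1 distance between \<open>p\<close> and its image under one step; its zeros
    in the simplex are the invariant vectors.\<close>
  define defect where
    "defect p = (\<Sum>w\<in>S. \<bar>(\<Sum>z\<in>S. p z * pmf (T z) w) - p w\<bar>)" for p
  obtain z0 where z0: "z0 \<in> S" using assms(2) by auto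
  define P where "P k = ((\<lambda>s. bind_pmf s T) ^^ k) (return_pmf z0)" for k
  have P_support: "set_pmf (P k) \<subseteq> S" for k
    by (induction k) (use z0 assms(3) in \<open>auto simp: P_def markov_chain_on_def\<close>)
  have P_Suc: "pmf (P (Suc k)) w = (\<Sum>z\<in>S. pmf (P k) z * pmf (T z) w)" for k w
    using pmf_bind_finite[OF assms(1) P_support, of k T w] by (simp add: P_def)
  \<comment> \<open>Average of the laws at times 0 to n - 1. Since \<open>m 0\<close> is the zero
    vector, the claims below ask for n > 0.\<close>
  define m where "m n z = (\<Sum>k<n. pmf (P k) z) / real n" for n z
  have m_in: "m n \<in> prob_vectors S" if "n > 0" for n
  proof -
    have "pmf (P k) z = 0" if "z \<notin> S" for k z
      using P_support[of k] that by (auto simp: set_pmf_iff)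
    moreover have "(\<Sum>z\<in>S. \<Sum>k<n. pmf (P k) z) = real n"
      by (subst sum.swap) (simp add: sum_pmf_eq_1[OF assms(1) P_support])
    ultimately show ?thesis
      using that by (auto simp: prob_vectors_def m_def sum_nonneg simp flip: sum_divide_distrib)
  qed
  have m_defect: "defect (m n) \<le> real (card S) / real n" if "n > 0" for n
  proof -
    have "\<bar>(\<Sum>z\<in>S. m n z * pmf (T z) w) - m n w\<bar> \<le> 1 / real n" for w
    proof -
      have "(\<Sum>z\<in>S. m n z * pmf (T z) w) = (\<Sum>k<n. \<Sum>z\<in>S. pmf (P k) z * pmf (T z) w) / real n"
        by (subst sum.swap)
          (simp add: m_def sum_divide_distrib sum_distrib_right)
      also have "\<dots> = (\<Sum>k<n. pmf (P (Suc k)) w) / real n"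
        by (simp add: P_Suc)
      finally have "(\<Sum>z\<in>S. m n z * pmf (T z) w) - m n w
          = (\<Sum>k<n. pmf (P (Suc k)) w - pmf (P k) w) / real n"
        by (simp add: m_def sum_subtractf diff_divide_distrib)
      \<comment> \<open>One step only shifts the time index, so all but the two boundary terms
        cancel.\<close>
      also have "\<dots> = (pmf (P n) w - pmf (P 0) w) / real n"
        using sum_lessThan_telescope[of "\<lambda>k. pmf (P k) w" n] by simp
      finally have eq: "(\<Sum>z\<in>S. m n z * pmf (T z) w) - m n w
          = (pmf (P n) w - pmf (P 0) w) / real n" .
      have "\<bar>pmf (P n) w - pmf (P 0) w\<bar> \<le> 1"
        using pmf_le_1[of "P n" w] pmf_le_1[of "P 0" w] pmf_nonneg[of "P n" w]
          pmf_nonneg[of "P 0" w] by linarith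
      then show ?thesis
        unfolding eq by (simp add: divide_right_mono)
    qed
    then have "defect (m n) \<le> (\<Sum>w\<in>S. 1 / real n)"
      unfolding defect_def by (intro sum_mono)
    then show ?thesis by simp
  qed
  have "continuous_on (prob_vectors S) defect"
    unfolding defect_def
    by (intro continuous_intros continuous_on_product_coordinates)
       (auto intro: continuous_on_subset[OF continuous_on_product_coordinates])
  then obtain p where p: "p \<in> prob_vectors S" and
      p_min: "\<And>q. q \<in> prob_vectors S \<Longrightarrow> defect p \<le> defect q"
    using continuous_attains_inf[OF compact_prob_vectors[OF assms(1)]] m_in[of 1]
    by (metis empty_iff zero_less_one)
  have "defect p \<le> 0"
  proof (rule LIMSEQ_le_const)
    show "(\<lambda>n. real (card S) / real n) \<longlonglongrightarrow> 0"
      by (rule lim_const_over_n)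
    show "\<exists>N. \<forall>n\<ge>N. defect p \<le> real (card S) / real n"
      using p_min m_in m_defect by (intro exI[of _ 1]) (meson less_le_trans order_trans zero_less_one)
  qed
  then have "defect p = 0"
    unfolding defect_def by (meson abs_ge_zero order_antisym sum_nonneg)
  then have invariant: "(\<Sum>z\<in>S. p z * pmf (T z) w) = p w" if "w \<in> S" for w
    using that assms(1) unfolding defect_def by (simp add: sum_nonneg_eq_0_iff)
  obtain s where s: "pmf s = p" "set_pmf s \<subseteq> S"
    using prob_vector_is_pmf[OF assms(1) p] .
  have "bind_pmf s T = s"
  proof (rule pmf_eqI)
    fix w
    show "pmf (bind_pmf s T) w = pmf s w"
    \<comment> \<open>\<open>defect\<close> tests only points of \<open>S\<close>; elsewhere both
      sides vanish because the chain does not leave \<open>S\<close>.\<close>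
    proof (cases "w \<in> S")
      case True
      then show ?thesis
        using invariant by (simp add: pmf_bind_finite[OF assms(1) s(2)] s(1))
    next
      case False
      then have "w \<notin> set_pmf s" "w \<notin> set_pmf (bind_pmf s T)"
        using s(2) assms(3) by (auto simp: markov_chain_on_def)
      then show ?thesis
        by (metis pmf_eq_0_set_pmf)
    qed
  qed
  with s(2) show ?thesis
    unfolding stationary_distribution_on_def by blast
qed

section \<open>Coupling two uniform choices without coincidence\<close>

text \<open>Each fibre is a block of exactly \<open>b\<close> consecutive numbers.\<close>

lemma map_div_pmf_of_set:
  fixes a b :: nat
  assumes "a > 0" "b > 0"
  shows "map_pmf (\<lambda>k. k div b) (pmf_of_set {..<a * b}) = pmf_of_set {..<a}"
proof (rule pmf_eqI)
  fix i
  have ne: "{..<a * b} \<noteq> {}" "{..<a} \<noteq> {}"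
    using assms by (simp_all add: lessThan_empty_iff)
  have "{..<a * b} \<inter> (\<lambda>k. k div b) -` {i} = (if i < a then {i * b..<i * b + b} else {})"
  proof -
    have fibre: "k div b = i \<longleftrightarrow> i * b \<le> k \<and> k < i * b + b" for k
      using assms div_less_iff_less_mult[of b k "Suc i"] less_eq_div_iff_mult_less_eq[of b i k]
      by (auto simp: add.commute)
    have range: "k < a * b \<longleftrightarrow> k div b < a" for k
      using assms by (simp add: div_less_iff_less_mult)
    show ?thesis
      by (rule set_eqI, cases "i < a") (simp_all only: range fibre[symmetric] Int_iff lessThan_iff
          vimage_singleton_eq atLeastLessThan_iff if_True if_False empty_iff, blast+)
  qed
  then show "pmf (map_pmf (\<lambda>k. k div b) (pmf_of_set {..<a * b})) i = pmf (pmf_of_set {..<a}) i"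
    using assms ne by (simp add: pmf_map measure_pmf_of_set)
qed

lemma bij_betw_Suc_mod:
  assumes "a > 0"
  shows "bij_betw (\<lambda>i. Suc i mod a) {..<a} {..<a}"
proof -
  have "inj_on (\<lambda>i. Suc i mod a) {..<a}"
    by (rule inj_onI) (auto simp: mod_Suc split: if_splits)
  moreover have "(\<lambda>i. Suc i mod a) ` {..<a} \<subseteq> {..<a}"
    using assms by auto
  ultimately show ?thesis
    by (simp add: bij_betw_def endo_inj_surj)
qed

text \<open>As b \<le> a, \<open>k div a\<close> is at most \<open>k div b\<close>, so equality
  could occur only when the shift wraps round to 0. But then k \<ge> (a - 1) b \<ge> 2 (a - 1) \<ge>
  a, so \<open>k div a\<close> is positive.\<close>

lemma shifted_div_neq:
  fixes a b k :: nat
  assumes "2 \<le> b" "b \<le> a" "k < a * b"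
  shows "Suc (k div b) mod a \<noteq> k div a"
proof
  assume eq: "Suc (k div b) mod a = k div a"
  have le: "k div a \<le> k div b"
    using assms by (intro div_le_mono2) auto
  have lt: "k div b < a"
    using assms by (simp add: less_mult_imp_div_less)
  show False
  proof (cases "Suc (k div b) = a")
    case True
    with eq have "k div a = 0" by simp
    then have "k < a"
      using assms by (simp add: div_eq_0_iff)
    have "(a - 1) * b \<le> k"
      using True by (metis diff_Suc_1 div_times_less_eq_dividend)
    moreover have "(a - 1) * 2 \<le> (a - 1) * b"
      using assms by simp
    ultimately show False
      using \<open>k < a\<close> assms by linarith
  next
    case False
    with lt eq le show False by simp
  qed
qed

text \<open>Both lists start with the same enumeration of the common elements. This reduces avoiding
  equal elements to avoiding equal indices.\<close>

lemma consistent_enumerations: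
  assumes "finite A" "finite B"
  obtains xs ys where "distinct xs" "set xs = A" "distinct ys" "set ys = B"
    "\<And>i j. i < length xs \<Longrightarrow> j < length ys \<Longrightarrow> xs ! i = ys ! j \<Longrightarrow> i = j"
proof -
  obtain cs where cs: "set cs = A \<inter> B" "distinct cs"
    using finite_distinct_list assms by (metis finite_Int finite_Diff)
  obtain as where as: "set as = A - B" "distinct as"
    using finite_distinct_list assms by (metis finite_Int finite_Diff)
  obtain bs where bs: "set bs = B - A" "distinct bs"
    using finite_distinct_list assms by (metis finite_Int finite_Diff)
  have "i = j" if "i < length (cs @ as)" "j < length (cs @ bs)" "(cs @ as) ! i = (cs @ bs) ! j"
    for i j
  proof -
    have "(cs @ as) ! i \<in> A" "(cs @ bs) ! j \<in> B"
      using nth_mem[OF that(1)] nth_mem[OF that(2)] cs as bs by auto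
    \<comment> \<open>Beyond the common prefix the entries belong to only one of the two sets, so
      equal entries must both lie in the prefix.\<close>
    moreover have "(cs @ as) ! i \<in> A - B" if "\<not> i < length cs"
      using that \<open>i < length (cs @ as)\<close> nth_mem[of "i - length cs" as] as(1)
      by (simp add: nth_append)
    moreover have "(cs @ bs) ! j \<in> B - A" if "\<not> j < length cs"
      using that \<open>j < length (cs @ bs)\<close> nth_mem[of "j - length cs" bs] bs(1)
      by (simp add: nth_append)
    ultimately have "i < length cs" "j < length cs"
      using that(3) by auto
    then show ?thesis
      using that(3) cs(2) by (simp add: nth_append nth_eq_iff_index_eq)
  qed
  then show thesis
    using that[of "cs @ as" "cs @ bs"] cs as bs by auto
qed

text \<open>One uniform number below a b drives both choices: its quotients by \<open>b\<close> and
  by \<open>a\<close> are uniform below \<open>a\<close> and \<open>b\<close>, and the cyclic shift,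
  being a bijection, preserves uniformity.\<close>

lemma avoiding_uniform_coupling_ordered:
  assumes "finite A" "finite B" "2 \<le> card B" "card B \<le> card A"
  shows "\<exists>r. map_pmf fst r = pmf_of_set A \<and> map_pmf snd r = pmf_of_set B \<and>
    (\<forall>(u, v)\<in>set_pmf r. u \<noteq> v)"
proof -
  obtain xs ys where xs: "distinct xs" "set xs = A" and ys: "distinct ys" "set ys = B"
    and same: "\<And>i j. i < length xs \<Longrightarrow> j < length ys \<Longrightarrow> xs ! i = ys ! j \<Longrightarrow> i = j"
    using consistent_enumerations[OF assms(1,2)] by metis
  define a where "a = length xs"
  define b where "b = length ys"
  have ab: "a = card A" "b = card B"
    using xs ys distinct_card[of xs] distinct_card[of ys] by (simp_all add: a_def b_def)
  then have pos: "2 \<le> b" "b \<le> a" "0 < b" "0 < a"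
    using assms by auto
  define r where
    "r = map_pmf (\<lambda>k. (xs ! (Suc (k div b) mod a), ys ! (k div a))) (pmf_of_set {..<a * b})"
  have ne: "{..<a} \<noteq> {}" "{..<b} \<noteq> {}" "{..<a * b} \<noteq> {}"
    using pos by (simp_all add: lessThan_empty_iff)
  have "map_pmf fst r = map_pmf (\<lambda>i. xs ! i) (map_pmf (\<lambda>i. Suc i mod a)
      (map_pmf (\<lambda>k. k div b) (pmf_of_set {..<a * b})))"
    by (simp add: r_def pmf.map_comp o_def)
  also have "\<dots> = pmf_of_set A"
    using pos ne xs bij_betw_nth[OF xs(1), of "{..<a}" A]
    by (simp add: map_div_pmf_of_set map_pmf_of_set_bij_betw[OF bij_betw_Suc_mod]
        map_pmf_of_set_bij_betw a_def)
  finally have r_fst: "map_pmf fst r = pmf_of_set A" .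
  have "map_pmf snd r = map_pmf (\<lambda>i. ys ! i) (map_pmf (\<lambda>k. k div a) (pmf_of_set {..<b * a}))"
    by (simp add: r_def pmf.map_comp o_def mult.commute)
  also have "\<dots> = pmf_of_set B"
    using pos ne ys bij_betw_nth[OF ys(1), of "{..<b}" B]
    by (simp add: map_div_pmf_of_set map_pmf_of_set_bij_betw b_def)
  finally have r_snd: "map_pmf snd r = pmf_of_set B" .
  have "xs ! (Suc (k div b) mod a) \<noteq> ys ! (k div a)" if "k < a * b" for k
  proof -
    have "k div a < b"
      using that by (simp add: less_mult_imp_div_less mult.commute)
    then show ?thesis
      using same[of "Suc (k div b) mod a" "k div a"] shifted_div_neq[OF pos(1,2) that] pos
      by (auto simp: a_def b_def)
  qed
  then have "\<forall>(u, v)\<in>set_pmf r. u \<noteq> v"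
    using ne by (auto simp: r_def)
  with r_fst r_snd show ?thesis by blast
qed

lemma avoiding_uniform_coupling:
  assumes "finite A" "finite B" "2 \<le> card A" "2 \<le> card B"
  shows "\<exists>r. map_pmf fst r = pmf_of_set A \<and> map_pmf snd r = pmf_of_set B \<and>
    (\<forall>(u, v)\<in>set_pmf r. u \<noteq> v)"
proof (cases "card B \<le> card A")
  case True
  then show ?thesis
    using assms avoiding_uniform_coupling_ordered by blast
next
  case False
  then obtain r where r: "map_pmf fst r = pmf_of_set B" "map_pmf snd r = pmf_of_set A"
      "\<forall>(u, v)\<in>set_pmf r. u \<noteq> v"
    using assms avoiding_uniform_coupling_ordered[of B A] by auto
  have "map_pmf fst (map_pmf prod.swap r) = pmf_of_set A"
    "map_pmf snd (map_pmf prod.swap r) = pmf_of_set B"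
    using r(1,2) by (simp_all add: pmf.map_comp o_def)
  moreover have "\<forall>(u, v)\<in>set_pmf (map_pmf prod.swap r). u \<noteq> v"
    using r(3) by auto
  ultimately show ?thesis by blast
qed

section \<open>The coupling of the walks\<close>

text \<open>Turns the finite sums that define the coupling into marginals; the support condition
  ensures that \<open>V\<close> misses no mass.\<close>

lemma sum_pmf_fst:
  assumes "finite V" "snd ` set_pmf r \<subseteq> V"
  shows "(\<Sum>v\<in>V. pmf r (u, v)) = pmf (map_pmf fst r) u"
proof -
  have "pmf (map_pmf fst r) u = measure (measure_pmf r) (fst -` {u} \<inter> set_pmf r)"
    by (simp add: pmf_map measure_Int_set_pmf)
  also have "fst -` {u} \<inter> set_pmf r = (Pair u ` V) \<inter> set_pmf r"
    using assms(2) by force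
  also have "measure (measure_pmf r) \<dots> = sum (pmf r) (Pair u ` V)"
    using assms(1) by (simp add: measure_Int_set_pmf measure_measure_pmf_finite)
  also have "\<dots> = (\<Sum>v\<in>V. pmf r (u, v))"
    by (simp add: sum.reindex inj_on_def)
  finally show ?thesis ..
qed

lemma sum_pmf_snd:
  assumes "finite V" "fst ` set_pmf r \<subseteq> V"
  shows "(\<Sum>u\<in>V. pmf r (u, v)) = pmf (map_pmf snd r) v"
proof -
  have "pmf (map_pmf prod.swap r) (v, u) = pmf r (u, v)" for u
    using pmf_map_inj'[of prod.swap r "(u, v)"] by simp
  moreover have "map_pmf fst (map_pmf prod.swap r) = map_pmf snd r"
    by (simp add: pmf.map_comp o_def)
  moreover have "snd ` set_pmf (map_pmf prod.swap r) \<subseteq> V"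
    using assms(2) by (auto simp: image_image)
  ultimately show ?thesis
    using sum_pmf_fst[OF assms(1), of "map_pmf prod.swap r" v] by simp
qed

text \<open>Without parallel arcs an outgoing arc is determined by its head. This makes a uniform
  neighbour a step of the simple random walk.\<close>

lemma (in nomulti_digraph) out_degree_eq_card_neighbours:
  "out_degree G x = card {y. x \<rightarrow>\<^bsub>G\<^esub> y}"
proof -
  have "inj_on (head G) (out_arcs G x)"
    by (rule inj_onI) (auto intro!: no_multi_arcs simp: arc_to_ends_def)
  moreover have "head G ` out_arcs G x = {y. x \<rightarrow>\<^bsub>G\<^esub> y}"
    by (auto simp: arcs_ends_def arc_to_ends_def image_iff)
  ultimately show ?thesis
    by (metis card_image out_degree_def)
qed

theorem mainTheorem8:
  fixes G :: "('a, 'b) pre_digraph"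
  assumes "graph G"
    and "Digraph_Component.connected G"
    and "bipartite G"
    and "\<forall>v\<in>verts G. out_degree G v \<ge> 2"
  shows "\<exists>T s. uniform_avoidance_coupling G T s"
proof -
  interpret graph G by fact
  define N where "N x = {y. x \<rightarrow>\<^bsub>G\<^esub> y}" for x
  have N_verts: "N x \<subseteq> verts G" for x
    unfolding N_def using adj_in_verts by auto
  then have N_fin: "finite (N x)" for x
    using finite_subset finite_verts by blast
  have N_card: "card (N x) = out_degree G x" for x
    by (simp add: N_def out_degree_eq_card_neighbours)
  have N_ne: "N x \<noteq> {}" if "x \<in> verts G" for x
    using assms(4) that N_card[of x] by force
  have srw: "pmf (pmf_of_set (N x)) x' = srw_prob G x x'" if "x \<in> verts G" for x x'
    using N_fin N_ne[OF that] by (auto simp: srw_prob_def N_card indicator_def) (auto simp: N_def)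
  obtain A B where AB: "verts G = A \<union> B" "A \<inter> B = {}"
    "\<And>u v. u \<rightarrow>\<^bsub>G\<^esub> v \<Longrightarrow> (u \<in> A \<and> v \<in> B) \<or> (u \<in> B \<and> v \<in> A)"
    using assms(3) unfolding bipartite_def by blast
  have "\<exists>r. map_pmf fst r = pmf_of_set (N x) \<and> map_pmf snd r = pmf_of_set (N y) \<and>
      (\<forall>(u, v)\<in>set_pmf r. u \<noteq> v)" if "x \<in> verts G" "y \<in> verts G" for x y
    using that assms(4) N_card N_fin by (intro avoiding_uniform_coupling) auto
  then obtain T where T: "\<And>x y. x \<in> verts G \<Longrightarrow> y \<in> verts G \<Longrightarrow>
      map_pmf fst (T (x, y)) = pmf_of_set (N x) \<and> map_pmf snd (T (x, y)) = pmf_of_set (N y) \<and>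
      (\<forall>(u, v)\<in>set_pmf (T (x, y)). u \<noteq> v)"
    by (subgoal_tac "\<exists>T. \<forall>z\<in>verts G \<times> verts G. map_pmf fst (T z) = pmf_of_set (N (fst z)) \<and>
        map_pmf snd (T z) = pmf_of_set (N (snd z)) \<and> (\<forall>(u, v)\<in>set_pmf (T z). u \<noteq> v)")
      (force, intro bchoice, auto)
  have T_step: "u \<in> N x \<and> v \<in> N y \<and> u \<noteq> v"
    if "x \<in> verts G" "y \<in> verts G" "(u, v) \<in> set_pmf (T (x, y))" for x y u v
  proof -
    have "u \<in> set_pmf (map_pmf fst (T (x, y)))" "v \<in> set_pmf (map_pmf snd (T (x, y)))"
      using that(3) by force+
    then show ?thesis
      using T[OF that(1,2)] that N_fin N_ne by auto
  qed
  \<comment> \<open>The chain is confined to distinct vertices on one side: both tokens change sides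
    at once, and \<open>T\<close> keeps them apart.\<close>
  define S where "S = {(x, y). x \<noteq> y \<and> (x \<in> A \<and> y \<in> A \<or> x \<in> B \<and> y \<in> B)}"
  have S_verts: "S \<subseteq> verts G \<times> verts G"
    using AB(1) by (auto simp: S_def)
  then have S_fin: "finite S"
    using finite_subset finite_verts by blast
  obtain v where v: "v \<in> verts G"
    using assms(2) by (auto simp: connected_def strongly_connected_def)
  \<comment> \<open>Two neighbours of one vertex lie on the same side, so they form a state of
    \<open>S\<close>.\<close>
  then obtain x y where xy: "x \<in> N v" "y \<in> N v" "x \<noteq> y"
    using assms(4) N_card[of v] N_fin[of v] card_le_Suc0_iff_eq[of "N v"] by force
  then have "(x, y) \<in> S"
    using AB(2) AB(3)[of v x] AB(3)[of v y] by (auto simp: S_def N_def)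
  then have S_ne: "S \<noteq> {}" by auto
  have S_chain: "markov_chain_on S T"
    unfolding markov_chain_on_def
  proof safe
    fix x y u w assume "(x, y) \<in> S" "(u, w) \<in> set_pmf (T (x, y))"
    then show "(u, w) \<in> S"
      using T_step[of x y u w] S_verts AB(2) AB(3)[of x u] AB(3)[of y w]
      by (auto simp: S_def N_def)
  qed
  obtain s where s: "stationary_distribution_on S T s"
    using stationary_distribution_exists[OF S_fin S_ne S_chain] by auto
  have s_support: "z \<in> S" if "pmf s z > 0" for z
    using s that by (auto simp: stationary_distribution_on_def set_pmf_iff)
  have "markov_chain_on (verts G \<times> verts G) T"
    unfolding markov_chain_on_def using T_step N_verts by fast
  moreover have "stationary_distribution_on (verts G \<times> verts G) T s"
    using s S_verts by (auto simp: stationary_distribution_on_def)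
  moreover have "pmf s (x, x) = 0" for x
    using s_support[of "(x, x)"] by (auto simp: S_def order.strict_iff_order)
  moreover have "pmf (T (x, y)) (y, u) = 0" if "pmf s (x, y) > 0" for x y u
  \<comment> \<open>If \<open>X\<close> could move onto \<open>y\<close>, then \<open>x\<close> and
    \<open>y\<close> would be adjacent, although states of \<open>S\<close> lie on one side.\<close>
  proof (rule ccontr)
    assume "pmf (T (x, y)) (y, u) \<noteq> 0"
    then have "x \<rightarrow>\<^bsub>G\<^esub> y"
      using T_step[of x y y u] s_support[OF that] S_verts by (auto simp: set_pmf_iff N_def)
    then show False
      using s_support[OF that] AB(2) AB(3)[of x y] by (auto simp: S_def)
  qed
  moreover have "(\<Sum>y'\<in>verts G. pmf (T (x, y)) (x', y')) = srw_prob G x x'"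
    "(\<Sum>x'\<in>verts G. pmf (T (x, y)) (x', y')) = srw_prob G y y'"
    if "x \<in> verts G" "y \<in> verts G" for x y x' y'
  proof -
    have "fst ` set_pmf (T (x, y)) \<subseteq> verts G" "snd ` set_pmf (T (x, y)) \<subseteq> verts G"
      using T_step[OF that] N_verts by fastforce+
    then show "(\<Sum>y'\<in>verts G. pmf (T (x, y)) (x', y')) = srw_prob G x x'"
      "(\<Sum>x'\<in>verts G. pmf (T (x, y)) (x', y')) = srw_prob G y y'"
      using T[OF that] srw that by (simp_all add: sum_pmf_fst sum_pmf_snd)
  qed
  ultimately have "uniform_avoidance_coupling G T s"
    unfolding uniform_avoidance_coupling_def markovian_avoidance_process_def by blast
  then show ?thesis by blast
qed

end
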